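(* Let $\Sigma$ be a valued monoid, $b$ a real number, $M$ a $\Sigma$-contracting space with central point $\omega$, $U$ a neighborhood of $\omega$ in $M$, and $f:(M,U)\to(\mathbb R_b,\mathbb R)$ a centred function (i.e. $f:U\to\mathbb R$ with $f(\omega)=b$). If $f$ is $\Sigma$-contactable and $f$ admits a local minimum at $\omega$, then its $\Sigma$-contact $\mathrm{K}_\Sigma f:M\to\mathbb R_b$ admits a global minimum at $\omega$.
   Context: A valued monoid is a (multiplicatively written) monoid $\Sigma$ with an absorbing element $0$, equipped with a monoid homomorphism $v:\Sigma\to\mathbb R_+=[0,+\infty[$ (multiplicative), called the valuation, such that $v(t)=0\iff t=0$, and there exists $t\in\Sigma$ with $0<v(t)<1$. A $\Sigma$-contracting space is a metric space $M$ with a central point $\omega\in M$ and an operation $\Sigma\times M\to M$, $(t,x)\mapsto t\star x$, such that $1\star x=x$; $t'\star(t\star x)=(t'\cdot t)\star x$; $0\star\omega=\omega$; $d(t\star x,t\star y)=v(t)d(x,y)$. A map $h$ between $\Sigma$-contracting spaces is $\Sigma$-homogeneous if $h(t\star x)=t\star h(x)$ for all $t,x$. $\mathbb R_b$ denotes the metric space $\mathbb R$ with central point $\omega=b$ and the canonical $\Sigma$-contracting structure $t\star y=b+v(t)(y-b)$. Let $M,M'$ be $\Sigma$-contracting spaces and $V,V'$ neighborhoods of $\omega$ in $M,M'$. A centred map $f:(M,V)\to(M',V')$ is a map $f:V\to V'$ with $f(\omega)=\omega$. It is $\Sigma$-contactable if there exists a $\Sigma$-homogeneous Lipschitz map $h:M\to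 M'$ such that $f$ is tangent to $h|_V$ at $\omega$, i.e. $\forall\varepsilon>0\ \exists\eta>0\ \forall x\in V\ (d(x,\omega)\le\eta\Rightarrow d(f(x),h(x))\le\varepsilon\,d(x,\omega))$. Such $h$ is unique, is denoted $\mathrm{K}_\Sigma f$ and called the $\Sigma$-contact of $f$. *)

theory Defs
  imports "HOL-Analysis.Analysis"
begin

text \<open>
  The underlying sets of valued monoids and of contracting spaces are types. As type variables are
  universally quantified in theorems and these sets are never empty, this loses no generality. The sort
  constraint on \<open>'s\<close> says exactly that \<open>'s\<close> is a monoid with a (two-sided) absorbing element \<open>0\<close>;
  commutativity is not assumed.
\<close>

locale valued_monoid =
  fixes v :: "'s::{monoid_mult, mult_zero} \<Rightarrow> real"
  assumes v_nonneg: "0 \<le> v t"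
    and v_one: "v 1 = 1"
    and v_mult: "v (s * t) = v s * v t"
    and v_eq_0_iff: "v t = 0 \<longleftrightarrow> t = 0"
    and v_contracting: "\<exists>t. 0 < v t \<and> v t < 1"

locale contracting_space = valued_monoid v
  for v :: "'s::{monoid_mult, mult_zero} \<Rightarrow> real" +
  fixes \<omega> :: "'m::metric_space"
    and star :: "'s \<Rightarrow> 'm \<Rightarrow> 'm"
  assumes star_one: "star 1 x = x"
    and star_star: "star s (star t x) = star (s * t) x"
    and star_zero_center: "star 0 \<omega> = \<omega>"
    and dist_star: "dist (star t x) (star t y) = v t * dist x y"

definition homogeneous :: "('s \<Rightarrow> 'm \<Rightarrow> 'm) \<Rightarrow> ('s \<Rightarrow> 'n \<Rightarrow> 'n) \<Rightarrow> ('m \<Rightarrow> 'n) \<Rightarrow> bool" where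
  "homogeneous star star' h \<longleftrightarrow> (\<forall>t x. h (star t x) = star' t (h x))"

definition real_star :: "('s \<Rightarrow> real) \<Rightarrow> real \<Rightarrow> 's \<Rightarrow> real \<Rightarrow> real" where
  "real_star v b t y = b + v t * (y - b)"

text \<open>
  A map \<open>f : V \<rightarrow> V'\<close> is represented by a total function of which only the values on \<open>V\<close> matter.
\<close>

definition centred_map ::
  "'m::topological_space \<Rightarrow> 'm set \<Rightarrow> 'n::topological_space \<Rightarrow> 'n set \<Rightarrow> ('m \<Rightarrow> 'n) \<Rightarrow> bool" where
  "centred_map \<omega> V \<omega>' V' f \<longleftrightarrow>
     \<omega> \<in> interior V \<and> \<omega>' \<in> interior V' \<and> f \<in> V \<rightarrow> V' \<and> f \<omega> = \<omega>'"

definition tangent_at ::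
  "'m::metric_space \<Rightarrow> 'm set \<Rightarrow> ('m \<Rightarrow> 'n::metric_space) \<Rightarrow> ('m \<Rightarrow> 'n) \<Rightarrow> bool" where
  "tangent_at \<omega> V f h \<longleftrightarrow>
     (\<forall>\<epsilon>>0. \<exists>\<eta>>0. \<forall>x\<in>V. dist x \<omega> \<le> \<eta> \<longrightarrow> dist (f x) (h x) \<le> \<epsilon> * dist x \<omega>)"

definition is_contact ::
  "('s \<Rightarrow> 'm::metric_space \<Rightarrow> 'm) \<Rightarrow> ('s \<Rightarrow> 'n::metric_space \<Rightarrow> 'n) \<Rightarrow> 'm \<Rightarrow> 'm set
    \<Rightarrow> ('m \<Rightarrow> 'n) \<Rightarrow> ('m \<Rightarrow> 'n) \<Rightarrow> bool" where
  "is_contact star star' \<omega> V f h \<longleftrightarrow>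
     homogeneous star star' h \<and> (\<exists>L. L-lipschitz_on UNIV h) \<and> tangent_at \<omega> V f h"

definition contactable ::
  "('s \<Rightarrow> 'm::metric_space \<Rightarrow> 'm) \<Rightarrow> ('s \<Rightarrow> 'n::metric_space \<Rightarrow> 'n) \<Rightarrow> 'm \<Rightarrow> 'm set
    \<Rightarrow> ('m \<Rightarrow> 'n) \<Rightarrow> bool" where
  "contactable star star' \<omega> V f \<longleftrightarrow> (\<exists>h. is_contact star star' \<omega> V f h)"

text \<open>Well defined for contactable centred maps by \<open>is_contact_unique\<close> below.\<close>

definition contact ::
  "('s \<Rightarrow> 'm::metric_space \<Rightarrow> 'm) \<Rightarrow> ('s \<Rightarrow> 'n::metric_space \<Rightarrow> 'n) \<Rightarrow> 'm \<Rightarrow> 'm set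
    \<Rightarrow> ('m \<Rightarrow> 'n) \<Rightarrow> ('m \<Rightarrow> 'n)" where
  "contact star star' \<omega> V f = (THE h. is_contact star star' \<omega> V f h)"

lemma contracting_space_real:
  assumes "valued_monoid v"
  shows "contracting_space v b (real_star v b)"
proof -
  interpret valued_monoid v by fact
  show ?thesis
  proof
    fix s t x y
    show "real_star v b 1 x = x" by (simp add: real_star_def v_one)
    show "real_star v b s (real_star v b t x) = real_star v b (s * t) x"
      by (simp add: real_star_def v_mult)
    show "real_star v b 0 b = b" by (simp add: real_star_def)
    have "real_star v b t x - real_star v b t y = v t * (x - y)"
      by (simp add: real_star_def algebra_simps)
    then show "dist (real_star v b t x) (real_star v b t y) = v t * dist x y"
      by (simp add: dist_real_def abs_mult v_nonneg)
  qed
qed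

context contracting_space
begin

lemma star_center: "star t \<omega> = \<omega>"
  by (metis star_star star_zero_center mult_zero_right)

lemma dist_star_center: "dist (star t x) \<omega> = v t * dist x \<omega>"
  by (metis dist_star star_center)

lemma v_power: "v (t ^ n) = v t ^ n"
  by (induction n) (simp_all add: v_one v_mult)

lemma small_v_ex:
  assumes "0 < e"
  shows "\<exists>t. 0 < v t \<and> v t < e"
proof -
  obtain t where t: "0 < v t" "v t < 1" using v_contracting by blast
  obtain n where "v t ^ n < e" using real_arch_pow_inv[OF assms t(2)] by blast
  then show ?thesis using t(1) v_power[of t n] by (metis zero_less_power)
qed

lemma star_near_center:
  assumes "\<omega> \<in> interior V" and "0 < \<eta>"
  shows "\<exists>t. 0 < v t \<and> star t x \<in> V \<and> dist (star t x) \<omega> \<le> \<eta>"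
proof -
  obtain r where r: "0 < r" "ball \<omega> r \<subseteq> V"
    using assms(1) by (meson mem_interior)
  define e where "e = min r \<eta>"
  have e: "0 < e" using r(1) assms(2) by (simp add: e_def)
  have pos: "0 < dist x \<omega> + 1" using zero_le_dist[of x \<omega>] by linarith
  obtain t where t: "0 < v t" "v t < e / (dist x \<omega> + 1)"
    using small_v_ex[of "e / (dist x \<omega> + 1)"] e pos by auto
  have "v t * (dist x \<omega> + 1) < e" using t(2) pos by (simp add: pos_less_divide_eq)
  then have "dist (star t x) \<omega> < e" using t(1) by (simp add: dist_star_center algebra_simps)
  then show ?thesis using t(1) r(2) unfolding e_def by (auto simp: dist_commute intro!: exI[of _ t])
qed

end

lemma is_contact_unique:
  assumes "contracting_space v \<omega> star" and "contracting_space v \<omega>' star'"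
    and "centred_map \<omega> V \<omega>' V' f"
    and "is_contact star star' \<omega> V f h" and "is_contact star star' \<omega> V f k"
  shows "h = k"
proof
  fix x
  interpret M: contracting_space v \<omega> star by fact
  interpret N: contracting_space v \<omega>' star' by fact
  have "dist (h x) (k x) \<le> 0 + e" if "0 < e" for e
  proof -
    define d where "d = e / (2 * (dist x \<omega> + 1))"
    have pos: "0 < dist x \<omega> + 1" using zero_le_dist[of x \<omega>] by linarith
    have d: "0 < d" using that pos by (simp add: d_def)
    obtain a where a: "0 < a" "\<And>y. y \<in> V \<Longrightarrow> dist y \<omega> \<le> a \<Longrightarrow> dist (f y) (h y) \<le> d * dist y \<omega>"
      using assms(4) d unfolding is_contact_def tangent_at_def by blast
    obtain c where c: "0 < c" "\<And>y. y \<in> V \<Longrightarrow> dist y \<omega> \<le> c \<Longrightarrow> dist (f y) (k y) \<le> d * dist y \<omega>"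
      using assms(5) d unfolding is_contact_def tangent_at_def by blast
    obtain t where t: "0 < v t" "star t x \<in> V" "dist (star t x) \<omega> \<le> min a c"
      using M.star_near_center[of V "min a c" x] a(1) c(1) assms(3)
      unfolding centred_map_def by auto
    have "v t * dist (h x) (k x) = dist (h (star t x)) (k (star t x))"
      using assms(4,5) by (simp add: is_contact_def homogeneous_def N.dist_star)
    also have "\<dots> \<le> 2 * d * dist (star t x) \<omega>"
      using a(2)[of "star t x"] c(2)[of "star t x"] t
        dist_triangle3[of "h (star t x)" "k (star t x)" "f (star t x)"] by simp
    also have "\<dots> = v t * (2 * d * dist x \<omega>)" by (simp add: M.dist_star_center)
    finally have "dist (h x) (k x) \<le> 2 * d * dist x \<omega>" using t(1) by simp
    also have "\<dots> \<le> 2 * d * (dist x \<omega> + 1)" using d by simp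
    also have "\<dots> = e"
    proof -
      have "2 * (e / (2 * q)) * q = e" if "0 < q" for q :: real using that by simp
      then show ?thesis unfolding d_def using pos by blast
    qed
    finally show ?thesis by simp
  qed
  then have "dist (h x) (k x) \<le> 0" by (rule field_le_epsilon)
  then show "h x = k x" by simp
qed

end

theory Submission
  imports Defs
begin

text \<open>
  For \<open>t\<close> with \<open>0 < v t\<close> small, \<open>star t x\<close> lies where \<open>b \<le> f\<close>, and there the contact \<open>h\<close> differs from
  \<open>f\<close> by at most \<open>\<epsilon> * dist (star t x) \<omega> = v t * \<epsilon> * dist x \<omega>\<close>. Homogeneity gives
  \<open>h (star t x) - b = v t * (h x - b)\<close>, so \<open>v t\<close> cancels and leaves \<open>h x - b \<ge> - \<epsilon> * dist x \<omega>\<close>.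
\<close>

lemma (in contracting_space) homogeneous_tangent_ge:
  assumes hom: "homogeneous star (real_star v b) h"
    and tan: "tangent_at \<omega> U f h"
    and U: "\<omega> \<in> interior U"
    and f: "f \<omega> = b"
    and min: "\<forall>\<^sub>F x in at \<omega> within U. b \<le> f x"
  shows "b \<le> h x"
proof (rule field_le_epsilon)
  fix e :: real
  assume e: "0 < e"
  \<comment> \<open>The \<open>+ 1\<close> keeps the denominator positive even when
    \<open>x = \<omega>\<close>.\<close>
  define d where "d = e / (dist x \<omega> + 1)"
  have pos: "0 < dist x \<omega> + 1" using zero_le_dist[of x \<omega>] by linarith
  have d: "0 < d" and d_le: "d * dist x \<omega> \<le> e"
    using e pos by (simp_all add: d_def field_simps)
  \<comment> \<open>The filter leaves out \<omega> itself; there \<open>f \<omega> = b\<close> gives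
    the bound.\<close>
  obtain r where r: "0 < r" "\<And>y. y \<in> U \<Longrightarrow> dist y \<omega> < r \<Longrightarrow> b \<le> f y"
    using min f unfolding eventually_at by (metis order_refl)
  obtain a where a: "0 < a"
      "\<And>y. y \<in> U \<Longrightarrow> dist y \<omega> \<le> a \<Longrightarrow> dist (f y) (h y) \<le> d * dist y \<omega>"
    using tan d unfolding tangent_at_def by blast
  \<comment> \<open>Halving \<open>r\<close> turns the non-strict bound into the strict one that
    \<open>r\<close> requires.\<close>
  obtain t where t: "0 < v t" "star t x \<in> U" "dist (star t x) \<omega> \<le> min a (r / 2)"
    using star_near_center[OF U, of "min a (r / 2)" x] a(1) r(1) by auto
  have "b \<le> f (star t x)" using r t by force
  also have "\<dots> \<le> h (star t x) + d * dist (star t x) \<omega>"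
    using a(2)[of "star t x"] t by (simp add: dist_real_def)
  also have "\<dots> = b + v t * (h x - b + d * dist x \<omega>)"
    using hom by (simp add: homogeneous_def real_star_def dist_star_center algebra_simps)
  finally have "0 \<le> h x - b + d * dist x \<omega>"
    using t(1) by (simp add: zero_le_mult_iff)
  then show "b \<le> h x + e" using d_le by linarith
qed

theorem theorem2p6p1:
  fixes v :: "'s::{monoid_mult, mult_zero} \<Rightarrow> real"
    and b :: real
    and \<omega> :: "'m::metric_space"
    and star :: "'s \<Rightarrow> 'm \<Rightarrow> 'm"
    and U :: "'m set"
    and f :: "'m \<Rightarrow> real"
  assumes "valued_monoid v"
    and "contracting_space v \<omega> star"
    and "centred_map \<omega> U b UNIV f"
    and "contactable star (real_star v b) \<omega> U f"
    and "\<forall>\<^sub>F x in at \<omega> within U. f \<omega> \<le> f x"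
  shows "\<forall>x. contact star (real_star v b) \<omega> U f \<omega> \<le> contact star (real_star v b) \<omega> U f x"
proof -
  interpret contracting_space v \<omega> star by fact
  let ?h = "contact star (real_star v b) \<omega> U f"
  \<comment> \<open>Unique existence makes the \<open>THE\<close> in \<open>contact\<close> denote
    an actual contact.\<close>
  have "\<exists>!h. is_contact star (real_star v b) \<omega> U f h"
    using assms(4) is_contact_unique[OF assms(2) contracting_space_real[OF assms(1)] assms(3)]
    unfolding contactable_def by blast
  then have "is_contact star (real_star v b) \<omega> U f ?h"
    unfolding contact_def by (rule theI')
  then have h: "homogeneous star (real_star v b) ?h" "tangent_at \<omega> U f ?h"
    by (simp_all add: is_contact_def)
  \<comment> \<open>Scaling by \<open>0\<close> fixes \<omega> in the source and sends every real to
    \<open>b\<close>, as \<open>v 0 = 0\<close>.\<close>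
  have "?h (star 0 \<omega>) = real_star v b 0 (?h \<omega>)"
    using h(1) unfolding homogeneous_def by blast
  then have "?h \<omega> = b"
    by (simp add: star_zero_center real_star_def v_eq_0_iff[THEN iffD2])
  moreover have "b \<le> ?h x" for x
    using homogeneous_tangent_ge[OF h] assms(3,5) by (auto simp: centred_map_def)
  ultimately show ?thesis by simp
qed

end
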